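(* Let $\lambda_1<\dots<\lambda_s$ in $\mathbb Q_{\ge0}^n$ be characteristic exponents, with associated integers $k_1,\dots,k_s$, $k=k_1\cdots k_s$ and semigroup generators $\gamma_1,\dots,\gamma_s$ as in the context. Let $i\in\{1,\dots,s\}$ and $a\in k\mathbb Z^n+\sum_{j=1}^{i}\mathbb Z\gamma_j$. There are integers $\alpha_j$, $j=1,\dots,n$, and $\beta_j$, $j=1,\dots,i$, such that $0\le\beta_j\le k_j-1$ and $$a=\sum_{j=1}^{n}\alpha_j k u_j+\sum_{j=1}^{i}\beta_j\gamma_j .$$ Furthermore, if $a\ge\sum_{j=1}^{i}(k_j-1)\gamma_j$ then $\alpha_j\ge0$ for all $j=1,\dots,n$.
   Context: $\mathbb R^n$ ($n\ge1$) carries the componentwise partial order: $a\le b$ iff $a_i\le b_i$ for all $i$; $a<b$ means $a\le b$ and $a\neq b$. $u_1,\dots,u_n$ is the canonical basis of $\mathbb R^n$. Characteristic exponents (of a germ of irreducible quasi-ordinary hypersurface in dimension $n+1$) are $n$-tuples $\lambda_1<\lambda_2<\dots<\lambda_s$ in $\mathbb Q_{\ge0}^n$ ($s\ge1$) such that, putting $M_0=\mathbb Z^n$ and $M_i=M_{i-1}+\mathbb Z\lambda_i$, one has $\lambda_i\notin M_{i-1}$ for $i=1,\dots,s$. Let $k_i$ be the smallest positive integer with $k_i\lambda_i\in M_{i-1}$, and $k=k_1k_2\cdots k_s$. Define $\gamma_1=k\lambda_1$ and $\gamma_{j+1}=k_j\gamma_j-k\lambda_j+k\lambda_{j+1}$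 for $j=1,\dots,s-1$. (The semigroup $\Gamma(\lambda_1,\dots,\lambda_s)$ of the hypersurface is generated by $ku_1,\dots,ku_n,\gamma_1,\dots,\gamma_s$.) *)

theory Defs
  imports "HOL-Analysis.Analysis"
begin

text \<open>
  Tuples are elements of \<^typ>\<open>real ^ 'n\<close>, whose library order is the componentwise one
  (\<open>a < b\<close> meaning \<open>a \<le> b\<close> and \<open>a \<noteq> b\<close>). Sequences \<open>\<lambda>\<^sub>1, \<dots>, \<lambda>\<^sub>s\<close> are functions on \<^typ>\<open>nat\<close>
  of which only the values at \<open>1, \<dots>, s\<close> are used.
\<close>

definition int_vectors :: "(real ^ 'n) set" where
  "int_vectors = {x. \<forall>j. x $ j \<in> \<int>}"

primrec exp_lattice :: "(nat \<Rightarrow> real ^ 'n) \<Rightarrow> nat \<Rightarrow> (real ^ 'n) set" where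
  "exp_lattice l 0 = int_vectors"
| "exp_lattice l (Suc i) = {x + of_int m *\<^sub>R l (Suc i) | x m. x \<in> exp_lattice l i}"

definition char_exponents :: "(nat \<Rightarrow> real ^ 'n) \<Rightarrow> nat \<Rightarrow> bool" where
  "char_exponents l s \<longleftrightarrow>
     1 \<le> s \<and>
     (\<forall>i\<in>{1..s}. \<forall>j. l i $ j \<in> \<rat> \<and> 0 \<le> l i $ j) \<and>
     (\<forall>i\<in>{1..<s}. l i < l (Suc i)) \<and>
     (\<forall>i\<in>{1..s}. l i \<notin> exp_lattice l (i - 1))"

definition exp_index :: "(nat \<Rightarrow> real ^ 'n) \<Rightarrow> nat \<Rightarrow> nat" where
  "exp_index l i = (LEAST m. 0 < m \<and> of_nat m *\<^sub>R l i \<in> exp_lattice l (i - 1))"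

definition exp_degree :: "(nat \<Rightarrow> real ^ 'n) \<Rightarrow> nat \<Rightarrow> nat" where
  "exp_degree l s = (\<Prod>i=1..s. exp_index l i)"

text \<open>The generators depend on \<open>s\<close> through \<open>k = k\<^sub>1 \<cdots> k\<^sub>s\<close>. The value at index 0 is a dummy.\<close>

fun semigroup_gen :: "(nat \<Rightarrow> real ^ 'n) \<Rightarrow> nat \<Rightarrow> nat \<Rightarrow> real ^ 'n" where
  "semigroup_gen l s 0 = 0"
| "semigroup_gen l s (Suc 0) = of_nat (exp_degree l s) *\<^sub>R l 1"
| "semigroup_gen l s (Suc (Suc j)) =
     of_nat (exp_index l (Suc j)) *\<^sub>R semigroup_gen l s (Suc j)
       - of_nat (exp_degree l s) *\<^sub>R l (Suc j)
       + of_nat (exp_degree l s) *\<^sub>R l (Suc (Suc j))"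

definition gen_lattice :: "(nat \<Rightarrow> real ^ 'n) \<Rightarrow> nat \<Rightarrow> nat \<Rightarrow> (real ^ 'n) set" where
  "gen_lattice l s i =
     {of_nat (exp_degree l s) *\<^sub>R z + (\<Sum>j=1..i. of_int (c j) *\<^sub>R semigroup_gen l s j) | z c.
        z \<in> int_vectors}"

end

theory Submission
  imports Defs
begin

text \<open>
  By induction \<open>\<gamma>\<^sub>j\<close> differs from \<open>k \<lambda>\<^sub>j\<close> by an element of \<open>k M\<^sub>j\<^sub>-\<^sub>1\<close>. Hence the group generated by
  \<open>k \<int>\<^sup>n\<close> and \<open>\<gamma>\<^sub>1, \<dots>, \<gamma>\<^sub>i\<close> is \<open>k M\<^sub>i\<close>, and \<open>k\<^sub>j \<gamma>\<^sub>j\<close> lies in \<open>k M\<^sub>j\<^sub>-\<^sub>1\<close>, so that the coefficients of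
  \<open>\<gamma>\<^sub>i, \<dots>, \<gamma>\<^sub>1\<close> can be reduced, in this order, modulo \<open>k\<^sub>i, \<dots>, k\<^sub>1\<close>. Since the \<open>\<gamma>\<^sub>j\<close> are nonnegative,
  subtracting \<open>\<Sum> \<beta>\<^sub>j \<gamma>\<^sub>j \<le> \<Sum> (k\<^sub>j - 1) \<gamma>\<^sub>j\<close> from a large \<open>a\<close> leaves a nonnegative vector.
\<close>

lemma exp_lattice_SucI: "x \<in> exp_lattice l i \<Longrightarrow> x + of_int m *\<^sub>R l (Suc i) \<in> exp_lattice l (Suc i)"
  by auto

lemma exp_lattice_add: "x \<in> exp_lattice l i \<Longrightarrow> y \<in> exp_lattice l i \<Longrightarrow> x + y \<in> exp_lattice l i"
proof (induction i arbitrary: x y)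
  case 0
  then show ?case by (auto simp: int_vectors_def)
next
  case (Suc i)
  from Suc.prems obtain x' m y' n where xy: "x' \<in> exp_lattice l i" "y' \<in> exp_lattice l i"
    "x = x' + of_int m *\<^sub>R l (Suc i)" "y = y' + of_int n *\<^sub>R l (Suc i)"
    by auto
  then have "x + y = (x' + y') + of_int (m + n) *\<^sub>R l (Suc i)"
    by (simp add: scaleR_left_distrib)
  with exp_lattice_SucI[OF Suc.IH[OF xy(1,2)], of "m + n"] show ?case by (simp only:)
qed

lemma exp_lattice_scale: "x \<in> exp_lattice l i \<Longrightarrow> of_int m *\<^sub>R x \<in> exp_lattice l i"
proof (induction i arbitrary: x)
  case 0
  then show ?case by (auto simp: int_vectors_def)
next
  case (Suc i)
  from Suc.prems obtain x' n where x: "x' \<in> exp_lattice l i" "x = x' + of_int n *\<^sub>R l (Suc i)"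
    by auto
  then have "of_int m *\<^sub>R x = of_int m *\<^sub>R x' + of_int (m * n) *\<^sub>R l (Suc i)"
    by (simp add: scaleR_right_distrib)
  with exp_lattice_SucI[OF Suc.IH[OF x(1)], of "m * n"] show ?case by (simp only:)
qed

lemma zero_in_exp_lattice: "0 \<in> exp_lattice l i"
proof (induction i)
  case (Suc i)
  have "0 = 0 + of_int 0 *\<^sub>R l (Suc i)" by simp
  with Suc show ?case by (simp only: exp_lattice.simps) blast
qed (simp add: int_vectors_def)

lemma int_vectors_subset_exp_lattice: "int_vectors \<subseteq> exp_lattice l i"
proof (induction i)
  case (Suc i)
  then show ?case using exp_lattice_SucI[of _ l i 0] by (simp only: of_int_0 scaleR_zero_left) auto
qed simp

text \<open>The product of the denominators of the coordinates clears all of them at once. This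
  supplies the witness that makes the \<open>LEAST\<close> in \<open>exp_index\<close>
  meaningful.\<close>

lemma rational_vector_common_denominator:
  fixes x :: "real ^ 'n"
  assumes "\<And>j. x $ j \<in> \<rat>"
  shows "\<exists>m::nat. 0 < m \<and> of_nat m *\<^sub>R x \<in> int_vectors"
proof -
  have "\<exists>d::nat. 0 < d \<and> of_nat d * (x $ j) \<in> \<int>" for j
  proof -
    obtain p q :: int where "q > 0" "x $ j = of_int p / of_int q"
      using Rats_cases'[OF assms[of j]] by metis
    then show ?thesis by (intro exI[of _ "nat q"]) auto
  qed
  then obtain d :: "'n \<Rightarrow> nat" where d: "\<And>j. 0 < d j" "\<And>j. of_nat (d j) * (x $ j) \<in> \<int>"
    by metis
  have "of_nat (\<Prod>j\<in>UNIV. d j) * (x $ h) \<in> \<int>" for h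
  proof -
    have "(\<Prod>j\<in>UNIV. d j) = d h * (\<Prod>j\<in>UNIV - {h}. d j)"
      by (simp add: prod.remove)
    then have "of_nat (\<Prod>j\<in>UNIV. d j) * (x $ h)
        = of_nat (\<Prod>j\<in>UNIV - {h}. d j) * (of_nat (d h) * (x $ h))"
      by (simp add: mult_ac)
    then show ?thesis using d(2)[of h] by (metis Ints_mult Ints_of_nat)
  qed
  then show ?thesis using d(1)
    by (intro exI[of _ "\<Prod>j\<in>UNIV. d j"]) (auto simp: int_vectors_def prod_pos)
qed

text \<open>A common denominator carries \<open>l i\<close> into \<open>int_vectors\<close>, which
  lies in every \<open>exp_lattice\<close>, so the set minimised by \<open>exp_index\<close> is
  nonempty and its least element belongs to it.\<close>

lemma exp_index_spec:
  assumes "char_exponents l s" "i \<in> {1..s}"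
  shows "0 < exp_index l i" "of_nat (exp_index l i) *\<^sub>R l i \<in> exp_lattice l (i - 1)"
proof -
  have "\<And>j. l i $ j \<in> \<rat>"
    using assms by (auto simp: char_exponents_def)
  then have "\<exists>m::nat. 0 < m \<and> of_nat m *\<^sub>R l i \<in> exp_lattice l (i - 1)"
    using rational_vector_common_denominator int_vectors_subset_exp_lattice by blast
  from LeastI_ex[OF this]
  show "0 < exp_index l i" "of_nat (exp_index l i) *\<^sub>R l i \<in> exp_lattice l (i - 1)"
    unfolding exp_index_def by auto
qed

text \<open>The correction \<open>w\<close> lies one level below the new exponent, so modulo
  \<open>k M\<^sub>j\<close> the generator with index \<open>Suc j\<close> can replace
  \<open>k\<close> times \<open>l (Suc j)\<close>, and conversely. The first correction is
  0.\<close>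

lemma semigroup_gen_eq:
  "\<exists>w\<in>exp_lattice l j. semigroup_gen l s (Suc j) = of_nat (exp_degree l s) *\<^sub>R (l (Suc j) + w)"
proof (induction j)
  case 0
  then show ?case by (intro bexI[of _ 0] zero_in_exp_lattice) simp
next
  case (Suc j)
  let ?k = "exp_index l (Suc j)"
  from Suc obtain w where w: "w \<in> exp_lattice l j"
    "semigroup_gen l s (Suc j) = of_nat (exp_degree l s) *\<^sub>R (l (Suc j) + w)"
    by blast
  \<comment> \<open>Read off from the recursion: multiplying \<open>l (Suc j) + w\<close> by
    \<open>?k\<close> and subtracting one copy of \<open>l (Suc j)\<close> leaves exactly this
    vector.\<close>
  define w' where "w' = of_int (int ?k) *\<^sub>R w + of_int (int ?k - 1) *\<^sub>R l (Suc j)"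
  have "w' \<in> exp_lattice l (Suc j)"
    unfolding w'_def by (intro exp_lattice_SucI exp_lattice_scale w)
  moreover have "semigroup_gen l s (Suc (Suc j))
      = of_nat (exp_degree l s) *\<^sub>R (l (Suc (Suc j)) + w')"
    by (simp add: w(2) w'_def algebra_simps)
  ultimately show ?case by blast
qed

text \<open>Multiplication by the index sends both summands of \<open>l (Suc j) + w\<close> into
  \<open>exp_lattice l j\<close>: the first by the choice of the index, the second because
  \<open>w\<close> is already there. This is the relation used for carrying.\<close>

lemma exp_index_semigroup_gen:
  assumes "char_exponents l s" "Suc j \<le> s"
  shows "\<exists>v\<in>exp_lattice l j.
    of_nat (exp_index l (Suc j)) *\<^sub>R semigroup_gen l s (Suc j) = of_nat (exp_degree l s) *\<^sub>R v"
proof -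
  let ?k = "exp_index l (Suc j)"
  obtain w where w: "w \<in> exp_lattice l j"
    "semigroup_gen l s (Suc j) = of_nat (exp_degree l s) *\<^sub>R (l (Suc j) + w)"
    using semigroup_gen_eq by blast
  have "of_nat ?k *\<^sub>R l (Suc j) \<in> exp_lattice l j"
    using exp_index_spec(2)[OF assms(1), of "Suc j"] assms(2) by simp
  moreover have "of_nat ?k *\<^sub>R w \<in> exp_lattice l j"
    using exp_lattice_scale[OF w(1), of "int ?k"] by simp
  ultimately have "of_nat ?k *\<^sub>R l (Suc j) + of_nat ?k *\<^sub>R w \<in> exp_lattice l j"
    by (rule exp_lattice_add)
  moreover have "of_nat ?k *\<^sub>R semigroup_gen l s (Suc j)
      = of_nat (exp_degree l s) *\<^sub>R (of_nat ?k *\<^sub>R l (Suc j) + of_nat ?k *\<^sub>R w)"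
    by (simp add: w(2) algebra_simps)
  ultimately show ?thesis by blast
qed

text \<open>Each generator up to index \<open>i\<close> is \<open>k\<close> times an element of
  \<open>exp_lattice l i\<close>. The inclusion moves the problem to the lattices
  \<open>M\<^sub>i\<close>, whose recursion fits the reduction below.\<close>

lemma gen_lattice_subset: "gen_lattice l s i \<subseteq> (\<lambda>x. of_nat (exp_degree l s) *\<^sub>R x) ` exp_lattice l i"
proof -
  let ?K = "of_nat (exp_degree l s) :: real"
  have "\<exists>x\<in>exp_lattice l i.
      ?K *\<^sub>R z + (\<Sum>j=1..i. of_int (c j) *\<^sub>R semigroup_gen l s j) = ?K *\<^sub>R x"
    if "z \<in> int_vectors" for z and c :: "nat \<Rightarrow> int"
  proof (induction i)
    case 0
    then show ?case using that by auto
  next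
    case (Suc i)
    then obtain x where x: "x \<in> exp_lattice l i"
      "?K *\<^sub>R z + (\<Sum>j=1..i. of_int (c j) *\<^sub>R semigroup_gen l s j) = ?K *\<^sub>R x" by blast
    obtain w where w: "w \<in> exp_lattice l i" "semigroup_gen l s (Suc i) = ?K *\<^sub>R (l (Suc i) + w)"
      using semigroup_gen_eq by blast
    have "(x + of_int (c (Suc i)) *\<^sub>R w) + of_int (c (Suc i)) *\<^sub>R l (Suc i)
        \<in> exp_lattice l (Suc i)"
      by (intro exp_lattice_SucI exp_lattice_add exp_lattice_scale x w)
    moreover have "?K *\<^sub>R z + (\<Sum>j=1..Suc i. of_int (c j) *\<^sub>R semigroup_gen l s j)
        = ?K *\<^sub>R x + of_int (c (Suc i)) *\<^sub>R semigroup_gen l s (Suc i)"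
      by (simp add: x(2)[symmetric] add.assoc)
    then have "?K *\<^sub>R z + (\<Sum>j=1..Suc i. of_int (c j) *\<^sub>R semigroup_gen l s j)
        = ?K *\<^sub>R ((x + of_int (c (Suc i)) *\<^sub>R w) + of_int (c (Suc i)) *\<^sub>R l (Suc i))"
      unfolding w(2) by (simp add: algebra_simps)
    ultimately show ?case by blast
  qed
  then show ?thesis by (auto simp: gen_lattice_def image_iff)
qed

text \<open>Works like a mixed radix expansion: the top coefficient is divided with remainder, the
  remainder becomes the digit, and the quotient is carried to the lower level. The carry changes the
  lower vector, hence \<open>x\<close> is arbitrary in the induction.\<close>

lemma exp_lattice_reduced_representation:
  assumes "char_exponents l s" "i \<le> s" "x \<in> exp_lattice l i"
  shows "\<exists>z\<in>int_vectors. \<exists>\<beta>::nat \<Rightarrow> int.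
    (\<forall>j\<in>{1..i}. 0 \<le> \<beta> j \<and> \<beta> j < int (exp_index l j)) \<and>
    of_nat (exp_degree l s) *\<^sub>R x
      = of_nat (exp_degree l s) *\<^sub>R z + (\<Sum>j=1..i. of_int (\<beta> j) *\<^sub>R semigroup_gen l s j)"
  using assms(2,3)
proof (induction i arbitrary: x)
  case 0
  then show ?case by auto
next
  case (Suc i)
  let ?K = "of_nat (exp_degree l s) :: real"
  let ?k = "exp_index l (Suc i)" and ?g = "semigroup_gen l s (Suc i)"
  obtain y m where y: "y \<in> exp_lattice l i" "x = y + of_int m *\<^sub>R l (Suc i)"
    using Suc.prems(2) by auto
  obtain w where w: "w \<in> exp_lattice l i" "?g = ?K *\<^sub>R (l (Suc i) + w)"
    using semigroup_gen_eq by blast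
  obtain v where v: "v \<in> exp_lattice l i" "of_nat ?k *\<^sub>R ?g = ?K *\<^sub>R v"
    using exp_index_semigroup_gen[OF assms(1) Suc.prems(1)] by blast
  have k: "0 < ?k" using exp_index_spec(1)[OF assms(1), of "Suc i"] Suc.prems(1) by simp
  define q r where "q = m div int ?k" and "r = m mod int ?k"
  have m: "m = q * int ?k + r" and r: "0 \<le> r" "r < int ?k"
    using k by (simp_all add: q_def r_def)
  \<comment> \<open>What remains below the digit \<open>r\<close>: replacing
    \<open>?K *\<^sub>R l (Suc i)\<close> by \<open>?g - ?K *\<^sub>R w\<close> costs
    \<open>m\<close> copies of \<open>w\<close>, and the carry of \<open>q\<close> multiples of
    \<open>?k\<close> contributes \<open>q\<close> copies of \<open>v\<close>.\<close>
  define x' where "x' = y + of_int (- m) *\<^sub>R w + of_int q *\<^sub>R v"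
  have "x' \<in> exp_lattice l i"
    unfolding x'_def by (intro exp_lattice_add exp_lattice_scale y w v)
  from Suc.IH[OF Suc_leD[OF Suc.prems(1)] this] obtain z and \<beta> :: "nat \<Rightarrow> int" where z: "z \<in> int_vectors"
    and \<beta>: "\<forall>j\<in>{1..i}. 0 \<le> \<beta> j \<and> \<beta> j < int (exp_index l j)"
    and eq: "?K *\<^sub>R x' = ?K *\<^sub>R z + (\<Sum>j=1..i. of_int (\<beta> j) *\<^sub>R semigroup_gen l s j)"
    by blast
  have "?K *\<^sub>R x = ?K *\<^sub>R (y + of_int (- m) *\<^sub>R w) + of_int m *\<^sub>R ?g"
    by (simp add: y(2) w(2) algebra_simps)
  also have "of_int m *\<^sub>R ?g = of_int q *\<^sub>R (of_nat ?k *\<^sub>R ?g) + of_int r *\<^sub>R ?g"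
    by (subst m) (simp add: scaleR_left_distrib)
  also have "?K *\<^sub>R (y + of_int (- m) *\<^sub>R w) + \<dots> = ?K *\<^sub>R x' + of_int r *\<^sub>R ?g"
    unfolding v(2) x'_def by (simp add: algebra_simps)
  finally have "?K *\<^sub>R x = ?K *\<^sub>R z
      + (\<Sum>j=1..Suc i. of_int ((\<beta>(Suc i := r)) j) *\<^sub>R semigroup_gen l s j)"
    by (simp add: eq add.assoc)
  moreover have "\<forall>j\<in>{1..Suc i}. 0 \<le> (\<beta>(Suc i := r)) j \<and> (\<beta>(Suc i := r)) j < int (exp_index l j)"
    using \<beta> r by (auto simp: le_Suc_eq)
  ultimately show ?case using z by blast
qed

text \<open>Regrouped, the recursion adds a nonnegative multiple of the previous generator and
  \<open>k\<close> times the difference of consecutive exponents, which is nonnegative since the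
  exponents increase.\<close>

lemma semigroup_gen_nonneg:
  assumes "char_exponents l s" "j \<le> s"
  shows "0 \<le> semigroup_gen l s j"
  using assms(2)
proof (induction j rule: induct_nat_012)
  case 1
  then have "0 \<le> l 1"
    using assms(1) by (simp add: char_exponents_def less_eq_vec_def)
  then show ?case by (simp add: scaleR_nonneg_nonneg)
next
  case (ge2 j)
  then have "l (Suc j) \<le> l (Suc (Suc j))"
    using assms(1) by (auto simp: char_exponents_def intro: less_imp_le)
  then have "0 \<le> of_nat (exp_degree l s) *\<^sub>R (l (Suc (Suc j)) - l (Suc j))"
    by (intro scaleR_nonneg_nonneg) auto
  moreover have "0 \<le> of_nat (exp_index l (Suc j)) *\<^sub>R semigroup_gen l s (Suc j)"
    using ge2 by (intro scaleR_nonneg_nonneg) auto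
  ultimately have "0 \<le> of_nat (exp_index l (Suc j)) *\<^sub>R semigroup_gen l s (Suc j)
      + of_nat (exp_degree l s) *\<^sub>R (l (Suc (Suc j)) - l (Suc j))"
    by (rule add_nonneg_nonneg[rotated])
  then show ?case by (simp add: algebra_simps)
qed simp

theorem theorem3:
  fixes l :: "nat \<Rightarrow> real ^ 'n" and s i :: nat and a :: "real ^ 'n"
  assumes "char_exponents l s"
    and "i \<in> {1..s}"
    and "a \<in> gen_lattice l s i"
  shows "\<exists>(\<alpha> :: 'n \<Rightarrow> int) (\<beta> :: nat \<Rightarrow> int).
    (\<forall>j\<in>{1..i}. 0 \<le> \<beta> j \<and> \<beta> j \<le> int (exp_index l j) - 1) \<and>
    a = (\<Sum>j\<in>UNIV. of_int (\<alpha> j) *\<^sub>R of_nat (exp_degree l s) *\<^sub>R axis j 1)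
        + (\<Sum>j=1..i. of_int (\<beta> j) *\<^sub>R semigroup_gen l s j) \<and>
    ((\<Sum>j=1..i. (of_nat (exp_index l j) - 1) *\<^sub>R semigroup_gen l s j) \<le> a
       \<longrightarrow> (\<forall>j. 0 \<le> \<alpha> j))"
proof -
  let ?K = "of_nat (exp_degree l s) :: real"
  obtain x where x: "x \<in> exp_lattice l i" "a = ?K *\<^sub>R x"
    using gen_lattice_subset assms(3) by blast
  obtain z and \<beta> :: "nat \<Rightarrow> int" where z: "z \<in> int_vectors"
    and \<beta>: "\<forall>j\<in>{1..i}. 0 \<le> \<beta> j \<and> \<beta> j < int (exp_index l j)"
    and a: "a = ?K *\<^sub>R z + (\<Sum>j=1..i. of_int (\<beta> j) *\<^sub>R semigroup_gen l s j)"
    using exp_lattice_reduced_representation[OF assms(1) _ x(1)] assms(2)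
    by (auto simp: x(2))
  \<comment> \<open>The coordinates of \<open>z\<close> are integers, so the floor only changes
    their type.\<close>
  define \<alpha> where "\<alpha> j = \<lfloor>z $ j\<rfloor>" for j
  have \<alpha>: "of_int (\<alpha> j) = z $ j" for j
    using z by (simp add: \<alpha>_def int_vectors_def)
  have Kz: "?K *\<^sub>R z = (\<Sum>j\<in>UNIV. of_int (\<alpha> j) *\<^sub>R ?K *\<^sub>R axis j 1)"
    by (simp add: vec_eq_iff \<alpha> axis_def if_distrib cong: if_cong)
  have K: "0 < ?K"
    using exp_index_spec(1)[OF assms(1)] by (auto simp: exp_degree_def intro!: prod_pos)
  have "0 \<le> \<alpha> h" if le: "(\<Sum>j=1..i. (of_nat (exp_index l j) - 1) *\<^sub>R semigroup_gen l s j) \<le> a" for h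
  proof -
    have "(\<Sum>j=1..i. of_int (\<beta> j) *\<^sub>R semigroup_gen l s j)
        \<le> (\<Sum>j=1..i. (of_nat (exp_index l j) - 1) *\<^sub>R semigroup_gen l s j)"
    proof (intro sum_mono scaleR_right_mono)
      fix j assume j: "j \<in> {1..i}"
      with \<beta> have "\<beta> j \<le> int (exp_index l j) - 1" by force
      then show "of_int (\<beta> j) \<le> (of_nat (exp_index l j) - 1 :: real)" by linarith
      show "0 \<le> semigroup_gen l s j"
        using semigroup_gen_nonneg[OF assms(1)] j assms(2) by simp
    qed
    also note le
    \<comment> \<open>The chain bounds the reduced sum by \<open>a\<close>; cancelling that sum from
      the expansion of \<open>a\<close> leaves the lattice part.\<close>
    finally have "0 \<le> ?K *\<^sub>R z" unfolding a by simp
    then have "0 \<le> ?K * z $ h" by (simp add: less_eq_vec_def)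
    with K have "0 \<le> z $ h" by (simp add: zero_le_mult_iff)
    then show ?thesis by (simp add: \<alpha>_def)
  qed
  moreover have "\<forall>j\<in>{1..i}. 0 \<le> \<beta> j \<and> \<beta> j \<le> int (exp_index l j) - 1"
    using \<beta> by auto
  ultimately show ?thesis using a unfolding Kz by blast
qed

end
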